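(* Consider the scenario program MSP$[\omega^{(1)},\dots,\omega^{(N)}]$ with $N$ sampled chance constraints in $\mathbb{R}^d$. Suppose that chance constraint $i\in\{1,\dots,N\}$ has support rank $\rho_i\in\{1,\dots,d\}$. Then its support dimension $\zeta_i$ in the MSP satisfies $\zeta_i\le\rho_i$.
   Context: Setting and standing assumptions. $\delta$ is a random variable with probability measure $\Pr$ and support set $\Delta$. $\mathbb{X}\subset\mathbb{R}^d$ is compact and convex, $c\in\mathbb{R}^d$, and $f_i:\mathbb{R}^d\times\Delta\to\mathbb{R}$, $i\in\{1,\dots,N\}$, are such that $f_i(\cdot,\delta)$ is convex for $\Pr$-almost every $\delta\in\Delta$. The underlying chance-constrained program is $\min_{x\in\mathbb{X}}c^{\mathrm T}x$ s.t. $\Pr[f_i(x,\delta)\le0]\ge1-\varepsilon_i$ for all $i$, with $\varepsilon_i\in(0,1)$, and is assumed to admit a feasible point. Scenario program. For sample sizes $K_1,\dots,K_N\ge d$ and $K=\sum_iK_i$, let $\omega^{(i)}=\{\delta^{(i,1)},\dots,\delta^{(i,K_i)}\}$, all samples $\delta^{(i,\kappa_i)}$ being i.i.d. copies of $\delta$, and $\omega=\{\omega^{(1)},\dots,\omega^{(N)}\}\in\Delta^K$, distributed according to the product measure $\Pr^K$. MSP$[\omega^{(1)},\dots,\omega^{(N)}]$ is $$\min_{x\in\mathbb{X}} c^{\mathrm T}x\quad\text{s.t.}\quad f_i(x,\delta^{(i,\kappa_i)})\le 0\quad\text{for all }\kappa_i\in\{1,\dots,K_i\},\ i\in\{1,\dots,N\}.$$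 For any numbers of samples it is assumed to be feasible almost surely (the exceptional null set being removed from $\Delta$). If there are several optimal points, a unique one is selected by a tie-break rule (e.g. the lexicographic order on $\mathbb{R}^d$); the resulting unique optimal point is $x^\star(\omega^{(1)},\dots,\omega^{(N)})$. Support constraints and support dimension. For a given multi-sample, the sampled constraint $f_i(x,\delta^{(i,\kappa_i)})\le0$ is a support constraint if its removal changes the optimal solution, i.e. $x^\star(\omega^{(1)},\dots,\omega^{(N)})\ne x^\star(\omega^{(1)},\dots,\omega^{(i-1)},\omega^{(i)}\setminus\{\delta^{(i,\kappa_i)}\},\omega^{(i+1)},\dots,\omega^{(N)})$. $\mathrm{Sc}_i$ is the (random) set of indices $\kappa_i\in\{1,\dots,K_i\}$ whose samples generate a support constraint. The support dimension $\zeta_i$ of chance constraint $i$ in the MSP is the smallest integer with $\operatorname{ess\,sup}_{\omega\in\Delta^K}|\mathrm{Sc}_i|\le\zeta_i$. Support rank. For $x\in\mathbb{R}^d$, $\delta\in\Delta$ let $F_i(x,\delta):=\{\xi\in\mathbb{R}^d : f_i(x+\xi,\delta)=f_i(x,\delta)\}$. Let $\mathcal{L}_i$ be the collection of all linear subspaces $L\subset\mathbb{R}^d$ with $L\subset F_i(x,\delta)$ for all $x\in\mathbb{R}^d$ and all $\delta\in\Delta$ (any $\Pr$-null set of $\delta$ that adversely influences the result may be removed from $\Delta$). $\mathcal{L}_i$ has a unique maximal element $L_i$ with respect to inclusion (the unconstrained subspace), and the support rank is $\rho_i:=d-\dim L_i$.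
   Formalization: The tie-break rule must be a total order whose strictly preferred sets are convex and which has least points on nonempty compact convex sets (e.g. lexicographic); for arbitrary rules, such as midpoints, the claim fails. Samples are removed by index, so equal samples stay distinct. *)

theory Defs
  imports "HOL-Probability.Probability"
begin

section \<open>Support rank\<close>

text \<open>Here \<open>g :: real ^ 'd \<Rightarrow> '\<delta> \<Rightarrow> real\<close> is a single constraint function \<open>f\<^sub>i\<close>, and the
  support set \<open>\<Delta>\<close> of the uncertainty is the space of the probability measure \<open>M\<close>.\<close>

definition invariance_set :: "(real ^ 'd \<Rightarrow> '\<delta> \<Rightarrow> real) \<Rightarrow> real ^ 'd \<Rightarrow> '\<delta> \<Rightarrow> (real ^ 'd) set" where
  "invariance_set g x \<delta> = {\<xi>. g (x + \<xi>) \<delta> = g x \<delta>}"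

text \<open>The almost-everywhere quantifier expresses that null sets may be removed from \<open>\<Delta>\<close>.\<close>

definition unconstrained_subspaces ::
    "'\<delta> measure \<Rightarrow> (real ^ 'd \<Rightarrow> '\<delta> \<Rightarrow> real) \<Rightarrow> (real ^ 'd) set set" where
  "unconstrained_subspaces M g =
     {L. subspace L \<and> (AE \<delta> in M. \<forall>x. L \<subseteq> invariance_set g x \<delta>)}"

definition unconstrained_subspace ::
    "'\<delta> measure \<Rightarrow> (real ^ 'd \<Rightarrow> '\<delta> \<Rightarrow> real) \<Rightarrow> (real ^ 'd) set" where
  "unconstrained_subspace M g =
     (THE L. L \<in> unconstrained_subspaces M g \<and>
             (\<forall>L' \<in> unconstrained_subspaces M g. L \<subseteq> L' \<longrightarrow> L' = L))"

definition support_rank :: "'\<delta> measure \<Rightarrow> (real ^ 'd \<Rightarrow> '\<delta> \<Rightarrow> real) \<Rightarrow> nat" where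
  "support_rank M g = CARD('d) - dim (unconstrained_subspace M g)"

lemma unconstrained_subspaces_sum:
  fixes g :: "real ^ 'd \<Rightarrow> '\<delta> \<Rightarrow> real"
  assumes "L \<in> unconstrained_subspaces M g" "L' \<in> unconstrained_subspaces M g"
  shows "{x + y |x y. x \<in> L \<and> y \<in> L'} \<in> unconstrained_subspaces M g"
proof -
  let ?S = "{x + y |x y. x \<in> L \<and> y \<in> L'}"
  have L: "subspace L" "AE \<delta> in M. \<forall>x. L \<subseteq> invariance_set g x \<delta>"
    and L': "subspace L'" "AE \<delta> in M. \<forall>x. L' \<subseteq> invariance_set g x \<delta>"
    using assms unfolding unconstrained_subspaces_def by blast+
  have "?S \<subseteq> invariance_set g x \<delta>"
    if "\<forall>x. L \<subseteq> invariance_set g x \<delta>" "\<forall>x. L' \<subseteq> invariance_set g x \<delta>" for x \<delta>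
  proof
    fix z assume "z \<in> ?S"
    then obtain u v where z: "z = u + v" "u \<in> L" "v \<in> L'" by blast
    have "v \<in> invariance_set g (x + u) \<delta>" "u \<in> invariance_set g x \<delta>"
      using that z(2,3) by blast+
    then show "z \<in> invariance_set g x \<delta>"
      unfolding invariance_set_def z(1) by (simp add: add.assoc)
  qed
  then have "AE \<delta> in M. \<forall>x. ?S \<subseteq> invariance_set g x \<delta>"
    by (intro eventually_elim2[OF L(2) L'(2)]) simp
  with subspace_sums[OF L(1) L'(1)] show ?thesis
    unfolding unconstrained_subspaces_def by blast
qed

lemma unconstrained_subspace_unique:
  fixes g :: "real ^ 'd \<Rightarrow> '\<delta> \<Rightarrow> real"
  shows "\<exists>!L. L \<in> unconstrained_subspaces M g \<and>
        (\<forall>L' \<in> unconstrained_subspaces M g. L \<subseteq> L' \<longrightarrow> L' = L)"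
proof -
  let ?A = "unconstrained_subspaces M g"
  have sub: "subspace L" if "L \<in> ?A" for L
    using that by (simp add: unconstrained_subspaces_def)
  have zero: "{0} \<in> ?A"
    by (simp add: unconstrained_subspaces_def invariance_set_def)
  have bound: "\<forall>L'. L' \<in> ?A \<longrightarrow> dim L' < Suc (dim (UNIV :: (real ^ 'd) set))"
    unfolding less_Suc_eq_le by (intro allI impI dim_subset subset_UNIV)
  have "\<exists>L. L \<in> ?A \<and> (\<forall>L'. L' \<in> ?A \<longrightarrow> dim L' \<le> dim L)"
    by (rule ex_has_greatest_nat[OF zero bound])
  then obtain L where *: "L \<in> ?A \<and> (\<forall>L'. L' \<in> ?A \<longrightarrow> dim L' \<le> dim L)" ..
  note L = conjunct1[OF *] and L_max = conjunct2[OF *, rule_format]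
  have max: "L' = L" if "L' \<in> ?A" "L \<subseteq> L'" for L'
    using subspace_dim_equal[OF sub[OF L] sub[OF that(1)] that(2) L_max[OF that(1)]] ..
  have unique: "L1 = L2" if A: "L1 \<in> ?A" "L2 \<in> ?A"
    and max1: "\<forall>L' \<in> ?A. L1 \<subseteq> L' \<longrightarrow> L' = L1" and max2: "\<forall>L' \<in> ?A. L2 \<subseteq> L' \<longrightarrow> L' = L2" for L1 L2
  proof -
    let ?S = "{x + y |x y. x \<in> L1 \<and> y \<in> L2}"
    have "?S \<in> ?A" using A by (rule unconstrained_subspaces_sum)
    moreover have "L1 \<subseteq> ?S"
    proof
      fix x assume "x \<in> L1"
      moreover have "x = x + 0" by simp
      ultimately show "x \<in> ?S" using subspace_0[OF sub[OF A(2)]] by blast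
    qed
    moreover have "L2 \<subseteq> ?S"
    proof
      fix x assume "x \<in> L2"
      moreover have "x = 0 + x" by simp
      ultimately show "x \<in> ?S" using subspace_0[OF sub[OF A(1)]] by blast
    qed
    ultimately have "?S = L1" "?S = L2" using max1 max2 by simp_all
    then show ?thesis by (rule trans[OF sym])
  qed
  show ?thesis
  proof (rule ex1I[of _ L])
    show "L \<in> ?A \<and> (\<forall>L' \<in> ?A. L \<subseteq> L' \<longrightarrow> L' = L)" using L max by blast
  next
    fix L' assume "L' \<in> ?A \<and> (\<forall>L'' \<in> ?A. L' \<subseteq> L'' \<longrightarrow> L'' = L')"
    then show "L' = L" using unique[of L' L] L max by blast
  qed
qed


section \<open>The multi-sample scenario program\<close>

text \<open>A multi-sample \<open>\<omega>\<close> assigns to each index \<open>(i, \<kappa>)\<close> the sample \<open>\<delta>\<^bsup>(i,\<kappa>)\<^esup>\<close>. Programs are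
  parameterised by the set \<open>I\<close> of indices whose sampled constraints are imposed, so that removing a
  sample means removing its index, and samples that happen to have equal values stay distinct.\<close>

definition sample_indices :: "nat \<Rightarrow> (nat \<Rightarrow> nat) \<Rightarrow> (nat \<times> nat) set" where
  "sample_indices N K = (SIGMA i:{1..N}. {1..K i})"

definition multisample_measure ::
    "'\<delta> measure \<Rightarrow> nat \<Rightarrow> (nat \<Rightarrow> nat) \<Rightarrow> (nat \<times> nat \<Rightarrow> '\<delta>) measure" where
  "multisample_measure M N K = (\<Pi>\<^sub>M p \<in> sample_indices N K. M)"

definition feasible_set ::
    "(real ^ 'd) set \<Rightarrow> (nat \<Rightarrow> real ^ 'd \<Rightarrow> '\<delta> \<Rightarrow> real) \<Rightarrow> (nat \<times> nat) set \<Rightarrow>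
     (nat \<times> nat \<Rightarrow> '\<delta>) \<Rightarrow> (real ^ 'd) set" where
  "feasible_set X f I \<omega> = {x \<in> X. \<forall>(i, \<kappa>) \<in> I. f i x (\<omega> (i, \<kappa>)) \<le> 0}"

definition optimal_set ::
    "(real ^ 'd) set \<Rightarrow> real ^ 'd \<Rightarrow> (nat \<Rightarrow> real ^ 'd \<Rightarrow> '\<delta> \<Rightarrow> real) \<Rightarrow> (nat \<times> nat) set \<Rightarrow>
     (nat \<times> nat \<Rightarrow> '\<delta>) \<Rightarrow> (real ^ 'd) set" where
  "optimal_set X c f I \<omega> =
     {x \<in> feasible_set X f I \<omega>. \<forall>y \<in> feasible_set X f I \<omega>. c \<bullet> x \<le> c \<bullet> y}"

text \<open>A tie-break rule is given by a total order \<open>le\<close> on \<open>\<real>\<^sup>d\<close> and selects the least optimal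
  point. It is required that the points strictly preferred to a given point form a convex set; an
  arbitrary choice of one point from each set of optimal points (such as the midpoint of an optimal
  interval in dimension one) would not do, because then the removal of a constraint could change the
  selected point without producing a point that is preferred to it. The last condition is that there
  is always a point to be selected: sets of optimal points of convex scenario programs are compact
  and convex. The lexicographic orders qualify by \<open>tie_break_rule_lex\<close> below.\<close>

definition tie_break_rule :: "(real ^ 'd \<Rightarrow> real ^ 'd \<Rightarrow> bool) \<Rightarrow> bool" where
  "tie_break_rule le \<longleftrightarrow>
     class.linorder le (\<lambda>x y. le x y \<and> x \<noteq> y) \<and>
     (\<forall>y. convex {x. le x y \<and> x \<noteq> y}) \<and>
     (\<forall>S. compact S \<and> convex S \<and> S \<noteq> {} \<longrightarrow> (\<exists>x \<in> S. \<forall>y \<in> S. le x y))"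

definition optimal_point ::
    "(real ^ 'd \<Rightarrow> real ^ 'd \<Rightarrow> bool) \<Rightarrow> (real ^ 'd) set \<Rightarrow> real ^ 'd \<Rightarrow>
     (nat \<Rightarrow> real ^ 'd \<Rightarrow> '\<delta> \<Rightarrow> real) \<Rightarrow> (nat \<times> nat) set \<Rightarrow> (nat \<times> nat \<Rightarrow> '\<delta>) \<Rightarrow> real ^ 'd" where
  "optimal_point le X c f I \<omega> =
     (THE x. x \<in> optimal_set X c f I \<omega> \<and> (\<forall>y \<in> optimal_set X c f I \<omega>. le x y))"

fun lex_le :: "'d list \<Rightarrow> real ^ 'd \<Rightarrow> real ^ 'd \<Rightarrow> bool" where
  "lex_le [] x y \<longleftrightarrow> True"
| "lex_le (j # js) x y \<longleftrightarrow> x $ j < y $ j \<or> (x $ j = y $ j \<and> lex_le js x y)"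

lemma lex_le_total: "lex_le js x y \<or> lex_le js y x"
  by (induction js) auto

lemma lex_le_refl: "lex_le js x x"
  by (induction js) auto

lemma lex_le_trans: "lex_le js x y \<Longrightarrow> lex_le js y z \<Longrightarrow> lex_le js x z"
  by (induction js) auto

lemma lex_le_antisym: "lex_le js x y \<Longrightarrow> lex_le js y x \<Longrightarrow> j \<in> set js \<Longrightarrow> x $ j = y $ j"
  by (induction js) auto

lemma lex_le_least:
  fixes S :: "(real ^ 'd) set"
  shows "compact S \<Longrightarrow> S \<noteq> {} \<Longrightarrow> \<exists>x \<in> S. \<forall>y \<in> S. lex_le js x y"
proof (induction js arbitrary: S)
  case Nil
  then show ?case by auto
next
  case (Cons j js)
  have "continuous_on S (\<lambda>x. x $ j)" by (intro continuous_intros)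
  then obtain m where m: "m \<in> S" "\<forall>y \<in> S. m $ j \<le> y $ j"
    using continuous_attains_inf[of S "\<lambda>x. x $ j"] Cons.prems by blast
  let ?T = "S \<inter> {x. x $ j = m $ j}"
  have "closed {x. x $ j = m $ j}"
    by (intro closed_Collect_eq continuous_intros)
  then have "compact ?T" using Cons.prems(1) by (rule compact_Int_closed[rotated])
  then obtain x where x: "x \<in> ?T" "\<forall>y \<in> ?T. lex_le js x y"
    using Cons.IH[of ?T] m(1) by blast
  have "lex_le (j # js) x y" if "y \<in> S" for y
    using x m(2) that by (cases "y $ j = m $ j") (auto simp: less_le)
  then show ?case using x(1) by blast
qed

lemma lex_less_convex: "convex {x. \<not> lex_le js y x}"
proof (induction js)
  case Nil
  then show ?case by simp
next
  case (Cons j js)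
  show ?case
  proof (rule convexI)
    fix a b :: "real ^ 'a" and u v :: real
    assume ab: "a \<in> {x. \<not> lex_le (j # js) y x}" "b \<in> {x. \<not> lex_le (j # js) y x}"
      and uv: "0 \<le> u" "0 \<le> v" "u + v = 1"
    let ?z = "u *\<^sub>R a + v *\<^sub>R b"
    have le: "a $ j \<le> y $ j" "b $ j \<le> y $ j" using ab by auto
    have z: "?z $ j = u * a $ j + v * b $ j" by simp
    have zy: "?z $ j \<le> y $ j"
      unfolding z using convex_bound_le[OF le uv] .
    show "?z \<in> {x. \<not> lex_le (j # js) y x}"
    proof (cases "u = 0 \<or> v = 0")
      case True
      then show ?thesis using ab uv by auto
    next
      case False
      then have pos: "u > 0" "v > 0" using uv by auto
      show ?thesis
      proof (cases "?z $ j = y $ j")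
        case True
        have "u * (y $ j - a $ j) + v * (y $ j - b $ j) = (u + v) * y $ j - ?z $ j"
          unfolding z by (simp add: algebra_simps)
        also have "\<dots> = 0" using True uv by simp
        finally have "u * (y $ j - a $ j) + v * (y $ j - b $ j) = 0" .
        moreover have "u * (y $ j - a $ j) \<ge> 0" "v * (y $ j - b $ j) \<ge> 0"
          using le uv by auto
        ultimately have "u * (y $ j - a $ j) = 0" "v * (y $ j - b $ j) = 0" by linarith+
        then have "a $ j = y $ j" "b $ j = y $ j" using pos by auto
        then have "\<not> lex_le js y a" "\<not> lex_le js y b" using ab by auto
        then have "\<not> lex_le js y ?z" using convexD[OF Cons.IH _ _ uv] by auto
        then show ?thesis using True by simp
      next
        case False
        then show ?thesis using zy by auto
      qed
    qed
  qed
qed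

lemma tie_break_rule_lex:
  assumes "set js = (UNIV :: 'd :: finite set)"
  shows "tie_break_rule (lex_le js)"
proof -
  have antisym: "x = y" if "lex_le js x y" "lex_le js y x" for x y :: "real ^ 'd"
    using lex_le_antisym[OF that] assms by (simp add: vec_eq_iff)
  have less: "{x. lex_le js x y \<and> x \<noteq> y} = {x. \<not> lex_le js y x}" for y :: "real ^ 'd"
    using antisym lex_le_total[of js] lex_le_refl by blast
  show ?thesis
    unfolding tie_break_rule_def less
  proof (intro conjI allI impI)
    show "class.linorder (lex_le js) (\<lambda>x y :: real ^ 'd. lex_le js x y \<and> x \<noteq> y)"
    proof unfold_locales
      show "(lex_le js x y \<and> x \<noteq> y) = (lex_le js x y \<and> \<not> lex_le js y x)" for x y :: "real ^ 'd"
        using antisym lex_le_refl by metis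
    qed (fact lex_le_refl lex_le_trans antisym lex_le_total)+
    show "convex {x. \<not> lex_le js y x}" for y :: "real ^ 'd"
      by (rule lex_less_convex)
    show "\<exists>x \<in> S. \<forall>y \<in> S. lex_le js x y" if "compact S \<and> convex S \<and> S \<noteq> {}" for S
      using that by (intro lex_le_least) blast+
  qed
qed


section \<open>Support constraints and support dimension\<close>

definition support_indices ::
    "(real ^ 'd \<Rightarrow> real ^ 'd \<Rightarrow> bool) \<Rightarrow> (real ^ 'd) set \<Rightarrow> real ^ 'd \<Rightarrow>
     (nat \<Rightarrow> real ^ 'd \<Rightarrow> '\<delta> \<Rightarrow> real) \<Rightarrow> nat \<Rightarrow> (nat \<Rightarrow> nat) \<Rightarrow> nat \<Rightarrow>
     (nat \<times> nat \<Rightarrow> '\<delta>) \<Rightarrow> nat set" where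
  "support_indices le X c f N K i \<omega> =
     {\<kappa> \<in> {1..K i}. optimal_point le X c f (sample_indices N K) \<omega> \<noteq>
                    optimal_point le X c f (sample_indices N K - {(i, \<kappa>)}) \<omega>}"

text \<open>\<open>Limsup (ae_filter M)\<close> is the essential supremum. The constant \<open>esssup\<close> is set to \<open>top\<close> on
  functions that are not measurable, and measurability of the number of support constraints is not
  among the assumptions; the two agree on measurable functions.\<close>

lemma Limsup_ae_filter_eq_esssup: "h \<in> borel_measurable M \<Longrightarrow> Limsup (ae_filter M) h = esssup M h"
  by (simp add: esssup_def)

definition support_dimension ::
    "'\<delta> measure \<Rightarrow> (real ^ 'd \<Rightarrow> real ^ 'd \<Rightarrow> bool) \<Rightarrow> (real ^ 'd) set \<Rightarrow> real ^ 'd \<Rightarrow>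
     (nat \<Rightarrow> real ^ 'd \<Rightarrow> '\<delta> \<Rightarrow> real) \<Rightarrow> nat \<Rightarrow> (nat \<Rightarrow> nat) \<Rightarrow> nat \<Rightarrow> nat" where
  "support_dimension M le X c f N K i =
     (LEAST n. Limsup (ae_filter (multisample_measure M N K))
                 (\<lambda>\<omega>. ereal (card (support_indices le X c f N K i \<omega>))) \<le> ereal n)"

end

theory Submission
  imports Defs
begin

text \<open>
  Let \<open>x\<close> be the optimal point of the full program, and \<open>y k\<close> the optimal point after removal of a
  support constraint \<open>k\<close> of chance constraint \<open>i\<close>; then \<open>y k\<close> violates no sampled constraint except \<open>k\<close>,
  and is strictly preferred to \<open>x\<close>. If there were more than \<open>\<rho>\<close> of these points, then a nontrivial
  linear combination of the vectors \<open>y k - x\<close> would lie in the unconstrained subspace \<open>L\<close>. As in Radon's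
  theorem, separating the coefficients by sign gives (up to a change of sign) a convex combination
  \<open>v\<close> of points \<open>y k\<close>, \<open>k \<in> P\<close>, and a convex combination \<open>u\<close> of \<open>x\<close> and points \<open>y k\<close>, \<open>k \<notin> P\<close>, such that
  \<open>v - u \<in> L\<close>. The constraints \<open>k \<notin> P\<close> hold at \<open>v\<close>; the constraints \<open>k \<in> P\<close> hold at \<open>u\<close>, and hence
  at \<open>v\<close>, by invariance along \<open>L\<close>. So \<open>v\<close> is feasible. But \<open>v\<close> is strictly preferred to \<open>x\<close>, as the
  preferred points form a convex set, which is a contradiction.
\<close>

section \<open>Linear dependence and Radon partitions modulo a subspace\<close>

text \<open>The components of the \<open>z k\<close> in the orthogonal complement of
  \<open>L\<close> live in dimension \<open>DIM('a) - dim L\<close>, so more than that many are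
  dependent; the coefficients of a dependence leave only components in \<open>L\<close>.\<close>

lemma nontrivial_combination_in_subspace:
  fixes L :: "'a::euclidean_space set" and z :: "'k \<Rightarrow> 'a"
  assumes L: "subspace L" and T: "finite T" "DIM('a) - dim L < card T"
  shows "\<exists>a. (\<Sum>k\<in>T. a k *\<^sub>R z k) \<in> L \<and> (\<exists>k\<in>T. a k \<noteq> 0)"
proof -
  define Q where "Q = {y \<in> UNIV. \<forall>x \<in> L. orthogonal x y}"
  have dimQ: "dim Q + dim L = DIM('a)"
    unfolding Q_def using dim_subspace_orthogonal_to_vectors[OF L subspace_UNIV] by simp
  have "\<exists>y. y \<in> Q \<and> z k - y \<in> L" for k
  proof -
    obtain l y where "l \<in> span L" "\<And>w. w \<in> span L \<Longrightarrow> orthogonal y w" "z k = l + y"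
      using orthogonal_subspace_decomp_exists[of L "z k"] by metis
    then show ?thesis using L unfolding Q_def
      by (intro exI[of _ y]) (auto simp: orthogonal_commute span_base span_eq_iff[THEN iffD2])
  qed
  then obtain y where y: "\<And>k. y k \<in> Q" "\<And>k. z k - y k \<in> L" by metis
  obtain a where a: "(\<Sum>k\<in>T. a k *\<^sub>R y k) = 0" "\<exists>k\<in>T. a k \<noteq> 0"
  proof (cases "inj_on y T")
    case True
    have "dim (y ` T) \<le> dim Q" using y by (intro dim_subset) blast
    also have "\<dots> < card (y ` T)" using T dimQ card_image[OF True] by linarith
    finally have "dependent (y ` T)"
      using independent_bound_general[of "y ` T"] dim_eq_card_independent by fastforce
    then obtain b where b: "\<exists>v\<in>y ` T. b v \<noteq> 0" "(\<Sum>v\<in>y ` T. b v *\<^sub>R v) = 0"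
      using T(1) by (auto simp: dependent_finite)
    show thesis
      using b that[of "b \<circ> y"] by (simp add: sum.reindex[OF True])
  next
    case False
    then obtain p q where pq: "p \<in> T" "q \<in> T" "p \<noteq> q" "y p = y q" by (auto simp: inj_on_def)
    let ?a = "\<lambda>k. (if k = p then 1 else 0) - (if k = q then 1 else 0 :: real)"
    have "(\<Sum>k\<in>T. ?a k *\<^sub>R y k) = 0"
      using pq T(1) by (simp add: scaleR_left_diff_distrib sum_subtractf if_distribR sum.delta
          if_distrib[of "\<lambda>t. t *\<^sub>R _"] cong: if_cong)
    moreover have "?a p \<noteq> 0" using pq by simp
    ultimately show thesis using that[of ?a] pq(1) by blast
  qed
  have "(\<Sum>k\<in>T. a k *\<^sub>R (z k - y k)) \<in> L"
    using y L by (intro subspace_sum subspace_scale) auto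
  then have "(\<Sum>k\<in>T. a k *\<^sub>R z k) \<in> L"
    using a(1) by (simp add: scaleR_diff_right sum_subtractf)
  with a(2) show ?thesis by blast
qed

text \<open>The point \<open>x\<close> is confined to the hull of \<open>u\<close>: later every
  generator of the hull of \<open>v\<close> has to be strictly preferred to
  \<open>x\<close>.\<close>

lemma radon_modulo_subspace:
  fixes L :: "'a::euclidean_space set" and y :: "'k \<Rightarrow> 'a"
  assumes L: "subspace L" and T: "finite T" "DIM('a) - dim L < card T"
  obtains P u v where "P \<subseteq> T" "v \<in> convex hull (y ` P)"
    "u \<in> convex hull (insert x (y ` (T - P)))" "v - u \<in> L"
proof -
  obtain b where b: "(\<Sum>k\<in>T. b k *\<^sub>R (y k - x)) \<in> L" "\<exists>k\<in>T. b k \<noteq> 0"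
    using nontrivial_combination_in_subspace[OF L T, of "\<lambda>k. y k - x"] by blast
  \<comment> \<open>In the combination of the \<open>y k - x\<close> the point \<open>x\<close> has
    coefficient minus the sum of the \<open>a k\<close>. A nonnegative sum makes it nonpositive,
    which puts \<open>x\<close> on the side of \<open>u\<close>.\<close>
  define a where "a = (if (\<Sum>k\<in>T. b k) \<ge> 0 then b else (\<lambda>k. - b k))"
  have aL: "(\<Sum>k\<in>T. a k *\<^sub>R (y k - x)) \<in> L"
    using b(1) subspace_neg[OF L b(1)] by (simp add: a_def sum_negf)
  have a_nz: "\<exists>k\<in>T. a k \<noteq> 0" using b(2) by (simp add: a_def)
  have a_sum: "(\<Sum>k\<in>T. a k) \<ge> 0" by (simp add: a_def sum_negf)
  define P where "P = {k \<in> T. a k > 0}"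
  define A where "A = (\<Sum>k\<in>P. a k)"
  define B where "B = (\<Sum>k\<in>T - P. - a k)"
  have P: "P \<subseteq> T" "finite P" using T(1) by (auto simp: P_def)
  have sign: "\<And>k. k \<in> P \<Longrightarrow> a k > 0" "\<And>k. k \<in> T - P \<Longrightarrow> - a k \<ge> 0"
    by (auto simp: P_def)
  have split: "sum h T = sum h P + sum h (T - P)" for h :: "'k \<Rightarrow> 'b::comm_monoid_add"
    using sum.subset_diff[OF P(1) T(1), of h] by (simp only: add.commute)
  have B: "B \<ge> 0" unfolding B_def by (intro sum_nonneg sign)
  have AB: "B \<le> A" using a_sum split[of a] by (simp add: A_def B_def sum_negf)
  \<comment> \<open>Needed to divide by \<open>A\<close>: without positive coefficients,
    \<open>B \<le> A = 0\<close> would make all the others vanish too.\<close>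
  have "P \<noteq> {}"
  proof
    assume "P = {}"
    then have "A = 0" by (simp add: A_def)
    then have "B = 0" using AB B by simp
    then have "\<forall>k\<in>T - P. - a k = 0"
      using sum_nonneg_eq_0_iff[of "T - P" "\<lambda>k. - a k"] T(1) sign(2) unfolding B_def by blast
    then show False using a_nz \<open>P = {}\<close> by simp
  qed
  then have A: "A > 0" unfolding A_def using P(2) sign(1) by (intro sum_pos)
  define v where "v = (\<Sum>k\<in>P. (a k / A) *\<^sub>R y k)"
  \<comment> \<open>The nonpositive coefficients contribute only weight \<open>B / A\<close>;
    \<open>x\<close> takes the rest.\<close>
  define u where "u = (\<Sum>k\<in>T - P. (- a k / A) *\<^sub>R y k) + ((A - B) / A) *\<^sub>R x"
  have v: "v \<in> convex hull (y ` P)"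
    unfolding v_def
  proof (rule convex_sum)
    have "(\<Sum>k\<in>P. a k / A) = A / A" by (simp only: A_def sum_divide_distrib)
    then show "(\<Sum>k\<in>P. a k / A) = 1" using A by simp
  qed (use A P(2) sign(1) in \<open>auto intro: hull_inc less_imp_le\<close>)
  \<comment> \<open>\<open>None\<close> is a fresh index for \<open>x\<close>, so its weight stays
    separate even if \<open>x\<close> equals some \<open>y k\<close>.\<close>
  let ?c = "\<lambda>k'. case k' of None \<Rightarrow> (A - B) / A | Some k \<Rightarrow> - a k / A"
  let ?w = "\<lambda>k'. case k' of None \<Rightarrow> x | Some k \<Rightarrow> y k"
  have sum_opt: "(\<Sum>k'\<in>insert None (Some ` (T - P)). h k') = h None + (\<Sum>k\<in>T - P. h (Some k))"
    for h :: "'k option \<Rightarrow> 'b::comm_monoid_add"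
    using T(1) by (subst sum.insert) (auto simp: sum.reindex)
  have "(\<Sum>k'\<in>insert None (Some ` (T - P)). ?c k' *\<^sub>R ?w k') \<in> convex hull (insert x (y ` (T - P)))"
  proof (rule convex_sum)
    have "(\<Sum>k\<in>T - P. - a k / A) = B / A"
      by (simp only: B_def sum_divide_distrib)
    then show "(\<Sum>k'\<in>insert None (Some ` (T - P)). ?c k') = 1"
      unfolding sum_opt using A by (simp add: field_simps)
  qed (use T(1) A AB sign(2) in
      \<open>auto simp: divide_nonpos_pos split: option.split intro: hull_inc\<close>)
  then have u: "u \<in> convex hull (insert x (y ` (T - P)))"
    unfolding sum_opt u_def by (simp add: add.commute)
  have Av: "A *\<^sub>R v = (\<Sum>k\<in>P. a k *\<^sub>R y k)"
    unfolding v_def using A by (simp add: scaleR_sum_right)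
  have Au: "A *\<^sub>R u = (A - B) *\<^sub>R x - (\<Sum>k\<in>T - P. a k *\<^sub>R y k)"
    unfolding u_def using A by (simp add: scaleR_add_right scaleR_diff_right scaleR_sum_right sum_negf)
  have Asum: "(\<Sum>k\<in>T. a k) = A - B" unfolding split[of a] A_def B_def by (simp add: sum_negf)
  have "(\<Sum>k\<in>T. a k *\<^sub>R (y k - x)) = (\<Sum>k\<in>T. a k *\<^sub>R y k) - (A - B) *\<^sub>R x"
    by (simp add: scaleR_diff_right sum_subtractf Asum flip: scaleR_sum_left)
  also have "\<dots> = A *\<^sub>R (v - u)"
    unfolding split[of "\<lambda>k. a k *\<^sub>R y k"] scaleR_diff_right[of A] Av Au by simp
  finally have "A *\<^sub>R (v - u) = (\<Sum>k\<in>T. a k *\<^sub>R (y k - x))" ..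
  then have "(1 / A) *\<^sub>R (A *\<^sub>R (v - u)) \<in> L"
    using aL subspace_scale[OF L] by metis
  then have "v - u \<in> L" using A by simp
  with P(1) v u show thesis by (rule that)
qed

section \<open>Preference order and existence of optimal points\<close>

text \<open>The strict order that compares costs first and then applies the tie-break, so that the
  selected optimal point is least among the feasible points.\<close>

definition preferred ::
    "(real ^ 'd \<Rightarrow> real ^ 'd \<Rightarrow> bool) \<Rightarrow> real ^ 'd \<Rightarrow> real ^ 'd \<Rightarrow> (real ^ 'd) set" where
  "preferred le c x = {y. c \<bullet> y < c \<bullet> x \<or> c \<bullet> y = c \<bullet> x \<and> le y x \<and> y \<noteq> x}"

text \<open>If both points tie with \<open>x\<close> in cost, so does their combination, and the
  convexity required of the tie-break rule decides. Otherwise one of them is strictly cheaper, and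
  its positive weight makes the combination strictly cheaper.\<close>

lemma convex_preferred:
  fixes le :: "real ^ 'd \<Rightarrow> real ^ 'd \<Rightarrow> bool"
  assumes "tie_break_rule le"
  shows "convex (preferred le c x)"
proof (rule convexI)
  fix a b :: "real ^ 'd" and u v :: real
  assume ab: "a \<in> preferred le c x" "b \<in> preferred le c x"
    and uv: "0 \<le> u" "0 \<le> v" "u + v = 1"
  let ?z = "u *\<^sub>R a + v *\<^sub>R b"
  have z: "c \<bullet> ?z = u * (c \<bullet> a) + v * (c \<bullet> b)" by (simp add: inner_add_right)
  have le: "c \<bullet> a \<le> c \<bullet> x" "c \<bullet> b \<le> c \<bullet> x" using ab by (auto simp: preferred_def)
  show "?z \<in> preferred le c x"
  proof (cases "u = 0 \<or> v = 0")
    case True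
    then show ?thesis using ab uv by auto
  next
    case False
    then have pos: "u > 0" "v > 0" using uv by auto
    show ?thesis
    proof (cases "c \<bullet> a = c \<bullet> x \<and> c \<bullet> b = c \<bullet> x")
      case True
      have "convex {y. le y x \<and> y \<noteq> x}" using assms by (auto simp: tie_break_rule_def)
      then have "?z \<in> {y. le y x \<and> y \<noteq> x}"
        by (rule convexD) (use ab True uv in \<open>auto simp: preferred_def\<close>)
      moreover have "c \<bullet> ?z = c \<bullet> x"
        unfolding z using True uv by (simp flip: distrib_right)
      ultimately show ?thesis by (simp add: preferred_def)
    next
      case False
      then have "u * (c \<bullet> a) < u * (c \<bullet> x) \<or> v * (c \<bullet> b) < v * (c \<bullet> x)"
        using le pos by auto
      moreover have "u * (c \<bullet> a) \<le> u * (c \<bullet> x)" "v * (c \<bullet> b) \<le> v * (c \<bullet> x)"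
        using le pos by auto
      ultimately have "c \<bullet> ?z < (u + v) * (c \<bullet> x)"
        unfolding z distrib_right by linarith
      then show ?thesis using uv by (simp add: preferred_def)
    qed
  qed
qed

lemma convex_sublevel_set:
  assumes "convex_on UNIV g"
  shows "convex {x. g x \<le> (b :: real)}"
proof (rule convexI)
  fix x y and u v :: real
  assume "x \<in> {x. g x \<le> b}" "y \<in> {x. g x \<le> b}" and uv: "0 \<le> u" "0 \<le> v" "u + v = 1"
  then have "u * g x + v * g y \<le> b" by (intro convex_bound_le) auto
  moreover have "g (u *\<^sub>R x + v *\<^sub>R y) \<le> u * g x + v * g y"
    using assms uv by (simp add: convex_on_def)
  ultimately show "u *\<^sub>R x + v *\<^sub>R y \<in> {x. g x \<le> b}" by simp
qed

text \<open>A real-valued convex function on the whole space is continuous, so sampled constraints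
  cut out closed convex sets. The cost attains its minimum on the compact feasible set, and the
  minimizers are cut out by a halfspace.\<close>

lemma optimal_set_compact_convex_nonempty:
  assumes X: "compact X" "convex X"
    and conv: "\<And>j \<kappa>. (j, \<kappa>) \<in> I \<Longrightarrow> convex_on UNIV (\<lambda>x. f j x (\<omega> (j, \<kappa>)))"
    and ne: "feasible_set X f I \<omega> \<noteq> {}"
  shows "compact (optimal_set X c f I \<omega>)" "convex (optimal_set X c f I \<omega>)"
    "optimal_set X c f I \<omega> \<noteq> {}"
proof -
  let ?F = "feasible_set X f I \<omega>"
  let ?H = "\<lambda>p. {x. f (fst p) x (\<omega> p) \<le> 0}"
  have F: "?F = X \<inter> (\<Inter>p\<in>I. ?H p)" by (fastforce simp: feasible_set_def)
  have "closed (?H p)" "convex (?H p)" if "p \<in> I" for p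
  proof -
    have *: "convex_on UNIV (\<lambda>x. f (fst p) x (\<omega> p))"
      using conv[of "fst p" "snd p"] that by simp
    then have "continuous_on UNIV (\<lambda>x. f (fst p) x (\<omega> p))"
      by (intro convex_on_continuous) auto
    then show "closed (?H p)" by (intro closed_Collect_le) auto
    show "convex (?H p)" using * by (rule convex_sublevel_set)
  qed
  then have F_cc: "compact ?F" "convex ?F"
    unfolding F using X
    by (auto intro!: compact_Int_closed convex_Int closed_INT convex_INT)
  have "continuous_on ?F (\<lambda>x. c \<bullet> x)" by (intro continuous_intros)
  then obtain m where m: "m \<in> ?F" "\<forall>y\<in>?F. c \<bullet> m \<le> c \<bullet> y"
    using continuous_attains_inf[OF F_cc(1) ne] by blast
  have O: "optimal_set X c f I \<omega> = ?F \<inter> {x. c \<bullet> x \<le> c \<bullet> m}"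
    unfolding optimal_set_def using m by (auto intro: order_trans)
  show "compact (optimal_set X c f I \<omega>)"
    unfolding O by (intro compact_Int_closed F_cc closed_halfspace_le)
  show "convex (optimal_set X c f I \<omega>)"
    unfolding O by (intro convex_Int F_cc convex_halfspace_le)
  show "optimal_set X c f I \<omega> \<noteq> {}" unfolding O using m by auto
qed

lemma optimal_point_least:
  fixes le :: "real ^ 'd \<Rightarrow> real ^ 'd \<Rightarrow> bool" and c :: "real ^ 'd"
  assumes "tie_break_rule le" "compact X" "convex X"
    and "\<And>j \<kappa>. (j, \<kappa>) \<in> I \<Longrightarrow> convex_on UNIV (\<lambda>x. f j x (\<omega> (j, \<kappa>)))"
    and "feasible_set X f I \<omega> \<noteq> {}"
  defines "x \<equiv> optimal_point le X c f I \<omega>"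
  shows "x \<in> optimal_set X c f I \<omega>" "\<And>y. y \<in> optimal_set X c f I \<omega> \<Longrightarrow> le x y"
proof -
  let ?O = "optimal_set X c f I \<omega>"
  interpret le: linorder le "\<lambda>x y. le x y \<and> x \<noteq> y"
    using assms(1) by (simp add: tie_break_rule_def)
  obtain m where m: "m \<in> ?O" "\<forall>y\<in>?O. le m y"
  proof -
    note O = optimal_set_compact_convex_nonempty[of X I f \<omega> c, OF assms(2-5)]
    have "\<exists>m\<in>?O. \<forall>y\<in>?O. le m y"
      by (rule assms(1)[unfolded tie_break_rule_def, THEN conjunct2, THEN conjunct2, rule_format])
        (use O in blast)
    then show thesis using that by blast
  qed
  have "x = m"
    unfolding x_def optimal_point_def using m le.order.antisym[of m]
    by (intro the_equality) blast+
  with m show "x \<in> ?O" "\<And>y. y \<in> ?O \<Longrightarrow> le x y" by auto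
qed

section \<open>Counting support constraints for a fixed multi-sample\<close>

lemma card_support_indices_le:
  fixes le :: "real ^ 'd \<Rightarrow> real ^ 'd \<Rightarrow> bool"
  assumes le: "tie_break_rule le" and X: "compact X" "convex X"
    and conv: "\<And>j \<kappa>. (j, \<kappa>) \<in> sample_indices N K \<Longrightarrow> convex_on UNIV (\<lambda>x. f j x (\<omega> (j, \<kappa>)))"
    and ne: "feasible_set X f (sample_indices N K) \<omega> \<noteq> {}"
    and L: "subspace L"
    and inv: "\<And>\<kappa> x. \<kappa> \<in> {1..K i} \<Longrightarrow> L \<subseteq> invariance_set (f i) x (\<omega> (i, \<kappa>))"
  shows "card (support_indices le X c f N K i \<omega>) \<le> CARD('d) - dim L"
proof (rule ccontr)
  interpret le: linorder le "\<lambda>x y. le x y \<and> x \<noteq> y"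
    using le by (simp add: tie_break_rule_def)
  let ?I = "sample_indices N K"
  let ?J = "\<lambda>\<kappa>. ?I - {(i, \<kappa>)}"
  let ?T = "support_indices le X c f N K i \<omega>"
  define x where "x = optimal_point le X c f ?I \<omega>"
  define y where "y = (\<lambda>\<kappa>. optimal_point le X c f (?J \<kappa>) \<omega>)"
  have fin: "finite ?T" and T: "?T \<subseteq> {1..K i}" by (auto simp: support_indices_def)
  have x: "x \<in> optimal_set X c f ?I \<omega>" "\<And>z. z \<in> optimal_set X c f ?I \<omega> \<Longrightarrow> le x z"
    unfolding x_def by (rule optimal_point_least[OF le X conv ne]; assumption)+
  have not_pref: "v \<notin> preferred le c x" if v: "v \<in> feasible_set X f ?I \<omega>" for v
  proof
    assume *: "v \<in> preferred le c x"
    have xv: "c \<bullet> x \<le> c \<bullet> v" using x(1) v by (simp add: optimal_set_def)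
    then have eq: "c \<bullet> v = c \<bullet> x" "le v x" "v \<noteq> x" using * by (auto simp: preferred_def)
    then have "v \<in> optimal_set X c f ?I \<omega>" using x(1) v by (simp add: optimal_set_def)
    then show False using x(2)[of v] eq le.order.antisym by blast
  qed
  have y: "y \<kappa> \<in> feasible_set X f (?J \<kappa>) \<omega>" "y \<kappa> \<in> preferred le c x" if "\<kappa> \<in> ?T" for \<kappa>
  proof -
    have sub: "feasible_set X f ?I \<omega> \<subseteq> feasible_set X f (?J \<kappa>) \<omega>"
      by (auto simp: feasible_set_def)
    have J_ne: "feasible_set X f (?J \<kappa>) \<omega> \<noteq> {}" using sub ne by auto
    have y\<kappa>: "y \<kappa> \<in> optimal_set X c f (?J \<kappa>) \<omega>"
      "\<And>z. z \<in> optimal_set X c f (?J \<kappa>) \<omega> \<Longrightarrow> le (y \<kappa>) z"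
      unfolding y_def by (rule optimal_point_least[OF le X conv J_ne]; simp)+
    then show "y \<kappa> \<in> feasible_set X f (?J \<kappa>) \<omega>" by (simp add: optimal_set_def)
    have x_feas: "x \<in> feasible_set X f (?J \<kappa>) \<omega>" using x(1) sub by (auto simp: optimal_set_def)
    have yx: "c \<bullet> y \<kappa> \<le> c \<bullet> x" using y\<kappa>(1) x_feas by (simp add: optimal_set_def)
    have neq: "y \<kappa> \<noteq> x" using that by (auto simp: support_indices_def x_def y_def)
    \<comment> \<open>Since \<open>x\<close> remains feasible after the removal, it competes with
      \<open>y \<kappa>\<close>. If the costs tie, \<open>x\<close> is optimal there as well, and
      the tie-break ranks \<open>y \<kappa>\<close> before it.\<close>
    show "y \<kappa> \<in> preferred le c x"
    proof (cases "c \<bullet> y \<kappa> = c \<bullet> x")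
      case True
      then have "x \<in> optimal_set X c f (?J \<kappa>) \<omega>" using y\<kappa>(1) x_feas by (simp add: optimal_set_def)
      then show ?thesis using y\<kappa>(2) neq True by (simp add: preferred_def)
    next
      case False
      then show ?thesis using yx by (simp add: preferred_def)
    qed
  qed
  have hull: "f j z (\<omega> (j, \<kappa>)) \<le> 0"
    if "(j, \<kappa>) \<in> ?I" "z \<in> convex hull S" "\<And>w. w \<in> S \<Longrightarrow> f j w (\<omega> (j, \<kappa>)) \<le> 0" for j \<kappa> z S
  proof -
    have "convex {w. f j w (\<omega> (j, \<kappa>)) \<le> 0}"
      using conv[OF that(1)] by (rule convex_sublevel_set)
    then show ?thesis using that hull_minimal[of S "{w. f j w (\<omega> (j, \<kappa>)) \<le> 0}" convex] by auto
  qed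
  assume "\<not> card ?T \<le> CARD('d) - dim L"
  then have "DIM(real ^ 'd) - dim L < card ?T" by simp
  from radon_modulo_subspace[OF L fin this, of y x] obtain P u v where
    P: "P \<subseteq> ?T" and v: "v \<in> convex hull (y ` P)"
    and u: "u \<in> convex hull (insert x (y ` (?T - P)))" and vu: "v - u \<in> L" .
  have "y ` P \<subseteq> preferred le c x" using y(2) P by blast
  then have "convex hull (y ` P) \<subseteq> preferred le c x"
    by (rule hull_minimal) (rule convex_preferred[OF le])
  then have v_pref: "v \<in> preferred le c x" using v by blast
  have "y ` P \<subseteq> X" using y(1) P by (auto simp: feasible_set_def)
  then have v_X: "v \<in> X" using hull_minimal[of _ X convex] X v by blast
  have "f j v (\<omega> (j, \<kappa>)) \<le> 0" if jk: "(j, \<kappa>) \<in> ?I" for j \<kappa>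
  \<comment> \<open>Outside this case, \<open>(j, \<kappa>)\<close> is not the removed index of any
    generator of \<open>v\<close>. Within it, \<open>\<kappa>\<close> differs from every index in
    \<open>?T - P\<close>, so all generators of \<open>u\<close> satisfy the constraint, and the
    step \<open>v - u\<close> in \<open>L\<close> keeps its value.\<close>
  proof (cases "j = i \<and> \<kappa> \<in> P")
    case False
    show ?thesis
      by (rule hull[OF jk v]) (use y(1) P jk False in \<open>auto simp: feasible_set_def\<close>)
  next
    case True
    have "f j u (\<omega> (j, \<kappa>)) \<le> 0"
      by (rule hull[OF jk u])
        (use y(1) x(1) jk True in \<open>fastforce simp: feasible_set_def optimal_set_def\<close>)
    moreover have "v - u \<in> invariance_set (f i) u (\<omega> (i, \<kappa>))"
      using vu inv[of \<kappa> u] True P T by blast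
    ultimately show ?thesis using True by (simp add: invariance_set_def)
  qed
  then have "v \<in> feasible_set X f ?I \<omega>" using v_X by (auto simp: feasible_set_def)
  then show False using not_pref v_pref by blast
qed

section \<open>From fixed multi-samples to almost every multi-sample\<close>

text \<open>Each coordinate of the product measure has law \<open>M\<close>, and there are only
  finitely many indices, so the exceptional sets still form a null set.\<close>

lemma AE_multisample:
  assumes M: "prob_space M"
    and P: "\<And>j. j \<in> {1..N} \<Longrightarrow> AE \<delta> in M. P j \<delta>"
  shows "AE \<omega> in multisample_measure M N K. \<forall>(j, \<kappa>)\<in>sample_indices N K. P j (\<omega> (j, \<kappa>))"
proof -
  have "AE \<omega> in multisample_measure M N K. P (fst p) (\<omega> p)" if "p \<in> sample_indices N K" for p
    unfolding multisample_measure_def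
    by (rule AE_PiM_component) (use that M P in \<open>auto simp: sample_indices_def\<close>)
  then have "AE \<omega> in multisample_measure M N K. \<forall>p\<in>sample_indices N K. P (fst p) (\<omega> p)"
    by (subst AE_finite_all) (auto simp: sample_indices_def)
  then show ?thesis by eventually_elim auto
qed

theorem lemma3p8:
  fixes M :: "'\<delta> measure"
    and X :: "(real ^ 'd) set"
    and c :: "real ^ 'd"
    and f :: "nat \<Rightarrow> real ^ 'd \<Rightarrow> '\<delta> \<Rightarrow> real"
    and \<epsilon> :: "nat \<Rightarrow> real"
    and le :: "real ^ 'd \<Rightarrow> real ^ 'd \<Rightarrow> bool"
    and N i :: nat
    and K :: "nat \<Rightarrow> nat"
  assumes "prob_space M"
    and "compact X" and "convex X"
    and "\<And>j. j \<in> {1..N} \<Longrightarrow> AE \<delta> in M. convex_on UNIV (\<lambda>x. f j x \<delta>)"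
    and "\<And>j x. j \<in> {1..N} \<Longrightarrow> x \<in> X \<Longrightarrow> {\<delta> \<in> space M. f j x \<delta> \<le> 0} \<in> sets M"
    and "\<And>j. j \<in> {1..N} \<Longrightarrow> 0 < \<epsilon> j \<and> \<epsilon> j < 1"
    and "\<exists>x\<in>X. \<forall>j\<in>{1..N}. measure M {\<delta> \<in> space M. f j x \<delta> \<le> 0} \<ge> 1 - \<epsilon> j"
    and "\<And>j. j \<in> {1..N} \<Longrightarrow> CARD('d) \<le> K j"
    and "\<And>K'. AE \<omega> in multisample_measure M N K'. feasible_set X f (sample_indices N K') \<omega> \<noteq> {}"
    and "tie_break_rule le"
    and "i \<in> {1..N}"
    and "support_rank M (f i) \<in> {1..CARD('d)}"
  shows "support_dimension M le X c f N K i \<le> support_rank M (f i)"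
proof -
  let ?L = "unconstrained_subspace M (f i)"
  have "?L \<in> unconstrained_subspaces M (f i)"
    unfolding unconstrained_subspace_def
    using theI'[OF unconstrained_subspace_unique[of M "f i"]] by blast
  then have L: "subspace ?L" "AE \<delta> in M. \<forall>x. ?L \<subseteq> invariance_set (f i) x \<delta>"
    by (auto simp: unconstrained_subspaces_def)
  \<comment> \<open>Convexity concerns every chance constraint, invariance along \<open>?L\<close>
    only the \<open>i\<close>-th, hence the guard \<open>j = i\<close>.\<close>
  let ?P = "\<lambda>j \<delta>. convex_on UNIV (\<lambda>x. f j x \<delta>) \<and>
    (j = i \<longrightarrow> (\<forall>x. ?L \<subseteq> invariance_set (f i) x \<delta>))"
  have "AE \<delta> in M. ?P j \<delta>" if "j \<in> {1..N}" for j
    using assms(4)[OF that] L(2) by eventually_elim simp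
  then have "AE \<omega> in multisample_measure M N K. \<forall>(j, \<kappa>)\<in>sample_indices N K. ?P j (\<omega> (j, \<kappa>))"
    by (rule AE_multisample[OF assms(1)])
  with assms(9)[of K] have "AE \<omega> in multisample_measure M N K.
    ereal (card (support_indices le X c f N K i \<omega>)) \<le> ereal (support_rank M (f i))"
  proof eventually_elim
    case (elim \<omega>)
    have "card (support_indices le X c f N K i \<omega>) \<le> support_rank M (f i)"
      unfolding support_rank_def
    proof (rule card_support_indices_le[OF assms(10,2,3) _ elim(1) L(1)])
      show "convex_on UNIV (\<lambda>x. f j x (\<omega> (j, \<kappa>)))" if "(j, \<kappa>) \<in> sample_indices N K" for j \<kappa>
        using elim(2) that by auto
      show "?L \<subseteq> invariance_set (f i) x (\<omega> (i, \<kappa>))" if "\<kappa> \<in> {1..K i}" for \<kappa> x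
      proof -
        have "(i, \<kappa>) \<in> sample_indices N K"
          using that assms(11) by (simp add: sample_indices_def)
        then show ?thesis using bspec[OF elim(2), of "(i, \<kappa>)"] by simp
      qed
    qed
    then show ?case by simp
  qed
  then have "Limsup (ae_filter (multisample_measure M N K))
      (\<lambda>\<omega>. ereal (card (support_indices le X c f N K i \<omega>))) \<le> ereal (support_rank M (f i))"
    by (rule Limsup_bounded)
  \<comment> \<open>The rank is itself a valid bound, hence a candidate for the \<open>LEAST\<close>
    in the support dimension.\<close>
  then show ?thesis
    unfolding support_dimension_def by (rule Least_le)
qed

end
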